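(* Let $(N_1,m_1)\vartriangleright_E(N_2,m_2)$ and let $G$ be a well-formed TFG for this equivalence. If $m$ is a marking in $R(N_1,m_1)$ or in $R(N_2,m_2)$, then there exists a total, well-defined configuration $c$ of $G$ with $c\equiv m$. Conversely, for every total, well-defined configuration $c$ of $G$, the marking $c_{|N_1}$ is in $R(N_1,m_1)$ if and only if $c_{|N_2}$ is in $R(N_2,m_2)$.
   Context: A Petri net $N=(P,T,\mathrm{Pre},\mathrm{Post})$ has a finite set of places $P$, a finite set of transitions $T$, and flow functions $\mathrm{Pre},\mathrm{Post}:T\to(P\to\mathbb{N})$. A marking is $m:P\to\mathbb{N}$; $t$ is enabled at $m$ if $m\ge\mathrm{Pre}(t)$, and firing gives $m-\mathrm{Pre}(t)+\mathrm{Post}(t)$. $R(N,m_0)$ is the set of markings reachable from $m_0$ by finite (possibly empty) firing sequences. Linear systems: $E$ is a finite collection of equations $x=y_1+\dots+y_l$, with variable set $\mathrm{fv}(E)$; solutions are non-negative integer; consistent means having a solution. For a partial map $c$ defined exactly on $v_1,\dots,v_k$, $[c]$ is the system $v_1=c(v_1),\dots,v_k=c(v_k)$; commas denote union. $E$-equivalence: $(N_1,m_1)\vartriangleright_E(N_2,m_2)$ (place sets $P_1,P_2$) iff (A1) $E,[m]$ consistent for every $m\in R(N_1,m_1)\cup R(N_2,m_2)$; (A2) $E,[m_1],[m_2]$ consistent; (A3) for all markings $m_1'$ of $N_1$, $m_2'$ of $N_2$ with $E,[m_1'],[m_2']$ consistent, $m_1'\in R(N_1,m_1)\iff m_2'\in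 R(N_2,m_2)$. TFGs: fix pairwise disjoint sets $K(n)$, $n\in\mathbb{N}$, of constant nodes of value $n$, disjoint from place/variable names; $K=\bigcup_nK(n)$. A TFG with places $P$ is $(V,R,A)$, $V=P\cup S$ with $S\subset K$ finite, $R,A\subseteq V\times V$ disjoint; $v\mathbin{\to\!\bullet} w$ iff $(v,w)\in R$, $v\mathbin{\circ\!\to} w$ iff $(v,w)\in A$, $v\to w$ for either. Roots have no incoming arc; $\circ$-leaves have no outgoing $A$-arc. $v\mathbin{\circ\!\to} X$: $X$ is the nonempty set of all $A$-successors of $v$; $X\mathbin{\to\!\bullet} v$: $X$ is the nonempty set of all $R$-predecessors of $v$. Well-formed TFG for $(N_1,m_1)\vartriangleright_E(N_2,m_2)$: (T1) $V\setminus K=P_1\cup P_2\cup\mathrm{fv}(E)$; (T2) nodes in $V\cap K$ are roots; (T3) not both $p\mathbin{\circ\!\to} q$ and $p'\to q$ with $p\ne p'$, and not both $p\mathbin{\to\!\bullet} q$ and $p\mathbin{\circ\!\to} q$; (T4) $v\mathbin{\circ\!\to} X$ or $X\mathbin{\to\!\bullet} v$ iff the equation $v=\sum_{x\in X}x$ is in $E$; (T5) acyclic; (T6) roots not in $K$ are exactly $P_2$, $\circ$-leaves not in $K$ exactly $P_1$. A configuration is a partial $c:V\to\mathbb{N}$ ($\bot$ where undefined) with $c(v)=n$ for $v\in V\cap K(n)$; total if defined everywhere; $c_{|N}$ is its restriction to the places of $N$. For a marking $m$, $c\equiv m$ means $c(p)=m(p)$ for all places $p$ where both are defined. $c$ is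 well-defined if (CBot) whenever $v\to w$, $c(v)=\bot\iff c(w)=\bot$; (CEq) whenever $c(v)\ne\bot$ and ($v\mathbin{\circ\!\to} X$ or $X\mathbin{\to\!\bullet} v$), $c(v)=\sum_{x\in X}c(x)$. *)

theory Defs
  imports Main "HOL-Library.Multiset"
begin

text \<open>
  The flow functions have type \<open>'t \<Rightarrow> 'v \<Rightarrow> nat\<close>; only their values on the transitions and
  places of the net matter. Markings are partial maps whose domain is exactly the set of
  places, so that markings of different nets, restrictions of configurations, and the systems
  \<open>[c]\<close> can all be handled as partial maps over a common type \<open>'v\<close> of nodes. The nets in an
  equivalence may share places.
\<close>

record ('v, 't) petri_net =
  places :: "'v set"
  transitions :: "'t set"
  Pre :: "'t \<Rightarrow> 'v \<Rightarrow> nat"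
  Post :: "'t \<Rightarrow> 'v \<Rightarrow> nat"

definition is_petri_net :: "('v, 't) petri_net \<Rightarrow> bool" where
  "is_petri_net N \<longleftrightarrow> finite (places N) \<and> finite (transitions N)"

definition marking :: "('v, 't) petri_net \<Rightarrow> ('v \<rightharpoonup> nat) \<Rightarrow> bool" where
  "marking N m \<longleftrightarrow> dom m = places N"

definition enabled :: "('v, 't) petri_net \<Rightarrow> ('v \<rightharpoonup> nat) \<Rightarrow> 't \<Rightarrow> bool" where
  "enabled N m t \<longleftrightarrow> (\<forall>p\<in>places N. Pre N t p \<le> the (m p))"

definition fire :: "('v, 't) petri_net \<Rightarrow> ('v \<rightharpoonup> nat) \<Rightarrow> 't \<Rightarrow> ('v \<rightharpoonup> nat)" where
  "fire N m t =
     (\<lambda>p. if p \<in> places N then Some (the (m p) - Pre N t p + Post N t p) else None)"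

inductive_set reachable :: "('v, 't) petri_net \<Rightarrow> ('v \<rightharpoonup> nat) \<Rightarrow> ('v \<rightharpoonup> nat) set"
  for N :: "('v, 't) petri_net" and m0 :: "'v \<rightharpoonup> nat"
  where
    init: "m0 \<in> reachable N m0"
  | step: "m \<in> reachable N m0 \<Longrightarrow> t \<in> transitions N \<Longrightarrow> enabled N m t
             \<Longrightarrow> fire N m t \<in> reachable N m0"

text \<open>
  \<open>K n\<close> is the set of constant nodes of value \<open>n\<close>. A constant node occurring in an equation
  stands for its value; it is not a variable.
\<close>

definition constants :: "(nat \<Rightarrow> 'v set) \<Rightarrow> 'v set" where
  "constants K = (\<Union>n. K n)"

definition constant_family :: "(nat \<Rightarrow> 'v set) \<Rightarrow> bool" where
  "constant_family K \<longleftrightarrow> (\<forall>i j. i \<noteq> j \<longrightarrow> K i \<inter> K j = {})"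

text \<open>
  \<open>EqSum x {#y\<^sub>1, \<dots>, y\<^sub>l#}\<close> is the equation \<open>x = y\<^sub>1 + \<dots> + y\<^sub>l\<close>, and
  \<open>EqVal x n\<close> is the equation \<open>x = n\<close>, as used in the systems \<open>[c]\<close>.
\<close>

datatype 'v eqn = EqSum 'v "'v multiset" | EqVal 'v nat

definition sum_system :: "'v eqn set \<Rightarrow> bool" where
  "sum_system E \<longleftrightarrow> finite E \<and> (\<forall>e\<in>E. \<exists>x Y. e = EqSum x Y)"

fun eqn_nodes :: "'v eqn \<Rightarrow> 'v set" where
  "eqn_nodes (EqSum x Y) = insert x (set_mset Y)"
| "eqn_nodes (EqVal x n) = {x}"

definition fv :: "(nat \<Rightarrow> 'v set) \<Rightarrow> 'v eqn set \<Rightarrow> 'v set" where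
  "fv K E = (\<Union>e\<in>E. eqn_nodes e) - constants K"

fun satisfies :: "('v \<Rightarrow> nat) \<Rightarrow> 'v eqn \<Rightarrow> bool" where
  "satisfies s (EqSum x Y) \<longleftrightarrow> s x = (\<Sum>y\<in>#Y. s y)"
| "satisfies s (EqVal x n) \<longleftrightarrow> s x = n"

text \<open>
  Solutions are given as total valuations of nodes; the values outside the
  variables of the system play no role.
\<close>

definition solution :: "(nat \<Rightarrow> 'v set) \<Rightarrow> 'v eqn set \<Rightarrow> ('v \<Rightarrow> nat) \<Rightarrow> bool" where
  "solution K E s \<longleftrightarrow> (\<forall>n. \<forall>k\<in>K n. s k = n) \<and> (\<forall>e\<in>E. satisfies s e)"

definition consistent :: "(nat \<Rightarrow> 'v set) \<Rightarrow> 'v eqn set \<Rightarrow> bool" where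
  "consistent K E \<longleftrightarrow> (\<exists>s. solution K E s)"

definition sys :: "('v \<rightharpoonup> nat) \<Rightarrow> 'v eqn set" where
  "sys c = {EqVal v n | v n. c v = Some n}"

definition E_equivalent ::
  "(nat \<Rightarrow> 'v set) \<Rightarrow> 'v eqn set \<Rightarrow> ('v, 't1) petri_net \<Rightarrow> ('v \<rightharpoonup> nat)
     \<Rightarrow> ('v, 't2) petri_net \<Rightarrow> ('v \<rightharpoonup> nat) \<Rightarrow> bool" where
  "E_equivalent K E N1 m1 N2 m2 \<longleftrightarrow>
     (\<forall>m \<in> reachable N1 m1 \<union> reachable N2 m2. consistent K (E \<union> sys m)) \<and>
     consistent K (E \<union> sys m1 \<union> sys m2) \<and>
     (\<forall>m1' m2'. marking N1 m1' \<and> marking N2 m2' \<and> consistent K (E \<union> sys m1' \<union> sys m2') \<longrightarrow>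
        (m1' \<in> reachable N1 m1 \<longleftrightarrow> m2' \<in> reachable N2 m2))"

record 'v tfg =
  nodes :: "'v set"
  red_arcs :: "('v \<times> 'v) set"
  agg_arcs :: "('v \<times> 'v) set"

definition arcs :: "'v tfg \<Rightarrow> ('v \<times> 'v) set" where
  "arcs G = red_arcs G \<union> agg_arcs G"

definition is_tfg :: "(nat \<Rightarrow> 'v set) \<Rightarrow> 'v set \<Rightarrow> 'v tfg \<Rightarrow> bool" where
  "is_tfg K P G \<longleftrightarrow>
     P \<inter> constants K = {} \<and>
     (\<exists>S. finite S \<and> S \<subseteq> constants K \<and> nodes G = P \<union> S) \<and>
     red_arcs G \<subseteq> nodes G \<times> nodes G \<and>
     agg_arcs G \<subseteq> nodes G \<times> nodes G \<and>
     red_arcs G \<inter> agg_arcs G = {}"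

definition root :: "'v tfg \<Rightarrow> 'v \<Rightarrow> bool" where
  "root G v \<longleftrightarrow> v \<in> nodes G \<and> (\<forall>u. (u, v) \<notin> arcs G)"

definition agg_leaf :: "'v tfg \<Rightarrow> 'v \<Rightarrow> bool" where
  "agg_leaf G v \<longleftrightarrow> v \<in> nodes G \<and> (\<forall>w. (v, w) \<notin> agg_arcs G)"

text \<open>\<open>agg_to G v X\<close> is \<open>v \<circ>\<rightarrow> X\<close>, and \<open>red_from G X v\<close> is \<open>X \<rightarrow>\<bullet> v\<close>.\<close>

definition agg_to :: "'v tfg \<Rightarrow> 'v \<Rightarrow> 'v set \<Rightarrow> bool" where
  "agg_to G v X \<longleftrightarrow> X \<noteq> {} \<and> X = {w. (v, w) \<in> agg_arcs G}"

definition red_from :: "'v tfg \<Rightarrow> 'v set \<Rightarrow> 'v \<Rightarrow> bool" where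
  "red_from G X v \<longleftrightarrow> X \<noteq> {} \<and> X = {u. (u, v) \<in> red_arcs G}"

text \<open>
  The fifth conjunct (equations) quantifies over all sum equations \<open>v = \<Sum>Y\<close>, so that every
  equation of \<open>E\<close> comes from the graph; in particular \<open>E\<close> then has no equation with a repeated
  summand or an empty right-hand side. The node set is finite in all uses, so \<open>mset_set X\<close> contains each
  element of \<open>X\<close> once.
\<close>

definition well_formed ::
  "(nat \<Rightarrow> 'v set) \<Rightarrow> 'v tfg \<Rightarrow> 'v eqn set \<Rightarrow> ('v, 't1) petri_net \<Rightarrow> ('v, 't2) petri_net \<Rightarrow> bool"
  where
  "well_formed K G E N1 N2 \<longleftrightarrow>
     nodes G - constants K = places N1 \<union> places N2 \<union> fv K E \<and>
     (\<forall>v \<in> nodes G \<inter> constants K. root G v) \<and>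
     (\<forall>p p' q. p \<noteq> p' \<longrightarrow> \<not> ((p, q) \<in> agg_arcs G \<and> (p', q) \<in> arcs G)) \<and>
     (\<forall>p q. \<not> ((p, q) \<in> red_arcs G \<and> (p, q) \<in> agg_arcs G)) \<and>
     (\<forall>v Y. EqSum v Y \<in> E \<longleftrightarrow> (\<exists>X. Y = mset_set X \<and> (agg_to G v X \<or> red_from G X v))) \<and>
     acyclic (arcs G) \<and>
     {v. root G v \<and> v \<notin> constants K} = places N2 \<and>
     {v. agg_leaf G v \<and> v \<notin> constants K} = places N1"

definition configuration :: "(nat \<Rightarrow> 'v set) \<Rightarrow> 'v tfg \<Rightarrow> ('v \<rightharpoonup> nat) \<Rightarrow> bool" where
  "configuration K G c \<longleftrightarrow> dom c \<subseteq> nodes G \<and> (\<forall>n. \<forall>v \<in> nodes G \<inter> K n. c v = Some n)"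

definition total_configuration :: "'v tfg \<Rightarrow> ('v \<rightharpoonup> nat) \<Rightarrow> bool" where
  "total_configuration G c \<longleftrightarrow> dom c = nodes G"

text \<open>
  In the second conjunct every \<open>c x\<close> is defined, by the first conjunct.
\<close>

definition well_defined :: "'v tfg \<Rightarrow> ('v \<rightharpoonup> nat) \<Rightarrow> bool" where
  "well_defined G c \<longleftrightarrow>
     (\<forall>v w. (v, w) \<in> arcs G \<longrightarrow> (c v = None \<longleftrightarrow> c w = None)) \<and>
     (\<forall>v X. c v \<noteq> None \<and> (agg_to G v X \<or> red_from G X v) \<longrightarrow>
        c v = Some (\<Sum>x\<in>X. the (c x)))"

definition restrict_net :: "('v \<rightharpoonup> nat) \<Rightarrow> ('v, 't) petri_net \<Rightarrow> ('v \<rightharpoonup> nat)" where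
  "restrict_net c N = c |` places N"

definition agrees :: "('v \<rightharpoonup> nat) \<Rightarrow> ('v \<rightharpoonup> nat) \<Rightarrow> bool" where
  "agrees c m \<longleftrightarrow> (\<forall>p \<in> dom c \<inter> dom m. c p = m p)"

end

theory Submission imports Defs begin

text \<open>
  By (T4), the equations of \<open>E\<close> are exactly the conditions (CEq) on the arcs of \<open>G\<close>, so total,
  well-defined configurations of \<open>G\<close> and solutions of \<open>E\<close> are the same thing, up to values outside
  the nodes of \<open>G\<close>. A marking extends to a solution by (A1), hence to a configuration; and a
  configuration makes \<open>E, [c\<^sub>|\<^sub>N\<^sub>1], [c\<^sub>|\<^sub>N\<^sub>2]\<close> consistent, so (A3) applies.
\<close>

lemma arcs_subset_nodes:
  assumes "is_tfg K P G"
  shows "arcs G \<subseteq> nodes G \<times> nodes G"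
  using assms by (auto simp: is_tfg_def arcs_def)

lemma arc_equation_in_nodes:
  assumes "is_tfg K P G" and "agg_to G v X \<or> red_from G X v"
  shows "v \<in> nodes G" and "X \<subseteq> nodes G"
  using assms by (auto simp: is_tfg_def agg_to_def red_from_def)

text \<open>Restriction to the nodes of \<open>G\<close> makes \<open>c\<close> total by
  construction. (CEq) at a node is the equation that (T4) puts into \<open>E\<close>: here (T4) is
  read from graph to equations.\<close>

lemma solution_imp_configuration:
  assumes sol: "solution K E s"
    and tfg: "is_tfg K P G" and wf: "well_formed K G E N1 N2"
  defines "c \<equiv> (Some \<circ> s) |` nodes G"
  shows "configuration K G c" and "total_configuration G c" and "well_defined G c"
proof -
  show "configuration K G c"
    using sol by (auto simp: configuration_def c_def solution_def)
  show "total_configuration G c"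
    by (auto simp: total_configuration_def c_def)
  have "c v = Some (\<Sum>x\<in>X. the (c x))" if X: "agg_to G v X \<or> red_from G X v" for v X
  proof -
    note in_nodes = arc_equation_in_nodes[OF tfg X]
    have "EqSum v (mset_set X) \<in> E"
      using wf X unfolding well_formed_def by blast
    \<comment> \<open>The passage from \<open>mset_set X\<close> to a sum over \<open>X\<close> is
      valid for every set: for infinite \<open>X\<close> both sides are 0.\<close>
    then have "s v = (\<Sum>x\<in>X. s x)"
      using sol by (auto simp: solution_def sum_unfold_sum_mset)
    moreover have "(\<Sum>x\<in>X. the (c x)) = (\<Sum>x\<in>X. s x)"
      using in_nodes(2) by (intro sum.cong) (auto simp: c_def)
    ultimately show ?thesis
      using in_nodes(1) by (simp add: c_def)
  qed
  \<comment> \<open>(CBot) holds because both ends of an arc are nodes, where \<open>c\<close> is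
    defined.\<close>
  then show "well_defined G c"
    using arcs_subset_nodes[OF tfg] by (auto simp: well_defined_def c_def)
qed

text \<open>Here (T4) is read from equations to graph: each equation of \<open>E\<close> is an
  instance of (CEq). Since \<open>solution\<close> also fixes the constants outside
  \<open>G\<close>, \<open>c\<close> has to be extended beyond its domain.\<close>

lemma configuration_imp_solution:
  assumes const: "constant_family K" and sum: "sum_system E"
    and tfg: "is_tfg K P G" and wf: "well_formed K G E N1 N2"
    and c: "configuration K G c" "total_configuration G c" "well_defined G c"
  obtains s where "solution K E s" and "\<And>v. v \<in> nodes G \<Longrightarrow> c v = Some (s v)"
proof
  \<comment> \<open>Off the graph a constant node gets its own value, unique because the sets
    \<open>K n\<close> are disjoint; other nodes there get an arbitrary value.\<close>
  define s where "s v = (if v \<in> nodes G then the (c v) else THE n. v \<in> K n)" for v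
  show sc: "c v = Some (s v)" if "v \<in> nodes G" for v
    using that c(2) by (force simp: s_def total_configuration_def)
  have "s k = n" if k: "k \<in> K n" for k n
  proof (cases "k \<in> nodes G")
    case True
    then show ?thesis
      using k c(1) by (auto simp: s_def configuration_def)
  next
    case False
    have "(THE n. k \<in> K n) = n"
      using const k by (intro the_equality) (auto simp: constant_family_def)
    then show ?thesis
      using False by (simp add: s_def)
  qed
  moreover have "satisfies s e" if e: "e \<in> E" for e
  proof (cases e)
    case (EqSum v Y)
    then obtain X where Y: "Y = mset_set X" and X: "agg_to G v X \<or> red_from G X v"
      using wf e unfolding well_formed_def by blast
    note in_nodes = arc_equation_in_nodes[OF tfg X]
    have "c v = Some (\<Sum>x\<in>X. the (c x))"
      using c(3) X sc[OF in_nodes(1)] unfolding well_defined_def by blast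
    also have "(\<Sum>x\<in>X. the (c x)) = (\<Sum>x\<in>X. s x)"
      using in_nodes(2) sc by (intro sum.cong) auto
    finally show ?thesis
      using EqSum Y sc[OF in_nodes(1)] by (simp add: sum_unfold_sum_mset)
  next
    case (EqVal v n)
    then show ?thesis
      using sum e by (auto simp: sum_system_def)
  qed
  ultimately show "solution K E s"
    by (simp add: solution_def)
qed

theorem theorem1:
  fixes K :: "nat \<Rightarrow> 'v set"
    and N1 :: "('v, 't1) petri_net" and N2 :: "('v, 't2) petri_net"
    and m1 m2 :: "'v \<rightharpoonup> nat"
    and E :: "'v eqn set"
    and P :: "'v set" and G :: "'v tfg"
  assumes "constant_family K"
    and "is_petri_net N1" and "is_petri_net N2"
    and "places N1 \<inter> constants K = {}" and "places N2 \<inter> constants K = {}"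
    and "marking N1 m1" and "marking N2 m2"
    and "sum_system E"
    and "E_equivalent K E N1 m1 N2 m2"
    and "is_tfg K P G"
    and "well_formed K G E N1 N2"
  shows "(\<forall>m \<in> reachable N1 m1 \<union> reachable N2 m2.
            \<exists>c. configuration K G c \<and> total_configuration G c \<and> well_defined G c \<and> agrees c m) \<and>
         (\<forall>c. configuration K G c \<and> total_configuration G c \<and> well_defined G c \<longrightarrow>
            (restrict_net c N1 \<in> reachable N1 m1 \<longleftrightarrow> restrict_net c N2 \<in> reachable N2 m2))"
proof (intro conjI ballI allI impI)
  fix m
  assume "m \<in> reachable N1 m1 \<union> reachable N2 m2"
  then obtain s where s: "solution K (E \<union> sys m) s"
    using assms(9) unfolding E_equivalent_def consistent_def by blast
  then have sol: "solution K E s"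
    by (simp add: solution_def)
  have "s p = n" if "m p = Some n" for p n
  proof -
    have "EqVal p n \<in> sys m"
      using that by (simp add: sys_def)
    then show ?thesis
      using s by (force simp: solution_def)
  qed
  \<comment> \<open>\<open>agrees\<close> compares only where both maps are defined, and there both
    equal \<open>s\<close>.\<close>
  then have "agrees ((Some \<circ> s) |` nodes G) m"
    by (auto simp: agrees_def restrict_map_def)
  with solution_imp_configuration[OF sol assms(10,11)]
  show "\<exists>c. configuration K G c \<and> total_configuration G c \<and> well_defined G c \<and> agrees c m"
    by blast
next
  fix c
  assume c: "configuration K G c \<and> total_configuration G c \<and> well_defined G c"
  then obtain s where s: "solution K E s" and sc: "\<And>v. v \<in> nodes G \<Longrightarrow> c v = Some (s v)"
    using configuration_imp_solution[OF assms(1,8,10,11)] by blast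
  \<comment> \<open>By (T1) all places are nodes, so the restrictions of the total \<open>c\<close>
    have exactly the places as domain, as (A3) demands of markings.\<close>
  have "nodes G - constants K = places N1 \<union> places N2 \<union> fv K E"
    using assms(11) by (simp add: well_formed_def)
  then have places: "places N1 \<union> places N2 \<subseteq> nodes G"
    by blast
  then have "marking N1 (restrict_net c N1)" "marking N2 (restrict_net c N2)"
    using c by (auto simp: marking_def restrict_net_def total_configuration_def)
  \<comment> \<open>One \<open>s\<close> solves all three systems, since it coincides with
    \<open>c\<close> on the places of both nets.\<close>
  moreover have "solution K (E \<union> sys (restrict_net c N1) \<union> sys (restrict_net c N2)) s"
    using s sc places
    by (auto simp: solution_def sys_def restrict_net_def restrict_map_def split: if_splits)
  then have "consistent K (E \<union> sys (restrict_net c N1) \<union> sys (restrict_net c N2))"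
    by (auto simp: consistent_def)
  ultimately show "restrict_net c N1 \<in> reachable N1 m1 \<longleftrightarrow> restrict_net c N2 \<in> reachable N2 m2"
    using assms(9) by (simp add: E_equivalent_def)
qed

end
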